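(* Let $(A,\circ)$ be a finite-dimensional Novikov algebra over $\mathbf{k}$ and let $(V,l_A,r_A)$ be a finite-dimensional representation of $(A,\circ)$. Then $(V^*,\,l_A^*+r_A^*,\,-r_A^* )$ is a representation of $(A,\circ)$.
   Context: $\mathbf{k}$ is a field of characteristic zero. A Novikov algebra $(A,\circ)$: $(a\circ b)\circ c-a\circ(b\circ c)=(b\circ a)\circ c-b\circ(a\circ c)$ and $(a\circ b)\circ c=(a\circ c)\circ b$ for all $a,b,c\in A$. A representation of $(A,\circ)$ is a triple $(V,l_A,r_A)$ with $V$ a vector space and $l_A,r_A:A\to\mathrm{End}_{\mathbf{k}}(V)$ linear maps such that for all $a,b\in A$, $v\in V$: $l_A(a\circ b-b\circ a)v=l_A(a)l_A(b)v-l_A(b)l_A(a)v$; $l_A(a)r_A(b)v-r_A(b)l_A(a)v=r_A(a\circ b)v-r_A(b)r_A(a)v$; $l_A(a\circ b)v=r_A(b)l_A(a)v$; $r_A(a)r_A(b)v=r_A(b)r_A(a)v$. For a linear map $\varphi:A\to\mathrm{End}_{\mathbf{k}}(V)$, the map $\varphi^*:A\to\mathrm{End}_{\mathbf{k}}(V^* )$ is defined by $\langle\varphi^*(a)f,v\rangle=-\langle f,\varphi(a)v\rangle$ for $a\in A$, $f\in V^*$, $v\in V$. *)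

theory Defs
  imports Complex_Main "HOL-Library.Function_Algebras"
begin

definition finite_dimensional :: "('k::field \<Rightarrow> 'b::ab_group_add \<Rightarrow> 'b) \<Rightarrow> bool" where
  "finite_dimensional scale \<longleftrightarrow> (\<exists>B. finite_dimensional_vector_space scale B)"

locale novikov_algebra = vector_space scaleA
  for scaleA :: "'k::field_char_0 \<Rightarrow> 'a::ab_group_add \<Rightarrow> 'a" +
  fixes mult :: "'a \<Rightarrow> 'a \<Rightarrow> 'a" (infixl \<open>\<circ>\<^sub>A\<close> 70)
  assumes linear_mult_left: "Vector_Spaces.linear scaleA scaleA (\<lambda>a. a \<circ>\<^sub>A b)"
    and linear_mult_right: "Vector_Spaces.linear scaleA scaleA (\<lambda>b. a \<circ>\<^sub>A b)"
    and left_symmetric: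
      "(a \<circ>\<^sub>A b) \<circ>\<^sub>A c - a \<circ>\<^sub>A (b \<circ>\<^sub>A c) = (b \<circ>\<^sub>A a) \<circ>\<^sub>A c - b \<circ>\<^sub>A (a \<circ>\<^sub>A c)"
    and right_commutative: "(a \<circ>\<^sub>A b) \<circ>\<^sub>A c = (a \<circ>\<^sub>A c) \<circ>\<^sub>A b"

text \<open>
  The dual space is a set of functions rather than a type, so representations are carried by a
  subspace \<open>V\<close> of an ambient vector space; only the values of an operator on \<open>V\<close> matter.
\<close>

definition End_on :: "('k::field \<Rightarrow> 'v::ab_group_add \<Rightarrow> 'v) \<Rightarrow> 'v set \<Rightarrow> ('v \<Rightarrow> 'v) set" where
  "End_on scale V = {f. (\<forall>v\<in>V. f v \<in> V) \<and>
     (\<forall>v\<in>V. \<forall>w\<in>V. f (v + w) = f v + f w) \<and> (\<forall>c. \<forall>v\<in>V. f (scale c v) = scale c (f v))}"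

locale novikov_representation = novikov_algebra scaleA mult + V: vector_space scaleV
  for scaleA :: "'k::field_char_0 \<Rightarrow> 'a::ab_group_add \<Rightarrow> 'a"
    and mult :: "'a \<Rightarrow> 'a \<Rightarrow> 'a" (infixl \<open>\<circ>\<^sub>A\<close> 70)
    and scaleV :: "'k \<Rightarrow> 'v::ab_group_add \<Rightarrow> 'v" +
  fixes V :: "'v set" and l r :: "'a \<Rightarrow> 'v \<Rightarrow> 'v"
  assumes subspace_V: "V.subspace V"
    and l_End: "l a \<in> End_on scaleV V"
    and l_add: "v \<in> V \<Longrightarrow> l (a + b) v = l a v + l b v"
    and l_scale: "v \<in> V \<Longrightarrow> l (scaleA c a) v = scaleV c (l a v)"
    and r_End: "r a \<in> End_on scaleV V"
    and r_add: "v \<in> V \<Longrightarrow> r (a + b) v = r a v + r b v"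
    and r_scale: "v \<in> V \<Longrightarrow> r (scaleA c a) v = scaleV c (r a v)"
    and l_commutator: "v \<in> V \<Longrightarrow> l (a \<circ>\<^sub>A b - b \<circ>\<^sub>A a) v = l a (l b v) - l b (l a v)"
    and l_r: "v \<in> V \<Longrightarrow> l a (r b v) - r b (l a v) = r (a \<circ>\<^sub>A b) v - r b (r a v)"
    and l_mult: "v \<in> V \<Longrightarrow> l (a \<circ>\<^sub>A b) v = r b (l a v)"
    and r_commute: "v \<in> V \<Longrightarrow> r a (r b v) = r b (r a v)"

definition dual_space :: "('k::field \<Rightarrow> 'v::ab_group_add \<Rightarrow> 'v) \<Rightarrow> ('v \<Rightarrow> 'k) set" where
  "dual_space scale = {f. Vector_Spaces.linear scale (*) f}"

definition scale_fun :: "'k::field \<Rightarrow> ('v \<Rightarrow> 'k) \<Rightarrow> 'v \<Rightarrow> 'k" where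
  "scale_fun c f = (\<lambda>v. c * f v)"

definition dual_map :: "('a \<Rightarrow> 'v \<Rightarrow> 'v) \<Rightarrow> 'a \<Rightarrow> ('v \<Rightarrow> 'k::field) \<Rightarrow> 'v \<Rightarrow> 'k" where
  "dual_map \<phi> a f = (\<lambda>v. - f (\<phi> a v))"

end

theory Submission
  imports Defs
begin

text \<open>
  Every operator on \<open>V\<^sup>*\<close> in the statement is a transpose, and transposition turns an identity
  between operators on \<open>V\<close> into the one with all products reversed. Writing \<open>S a = l a + r a\<close>, the
  left action is minus the transpose of \<open>S a\<close>, and the right action is the transpose of \<open>r a\<close>, since
  the two signs cancel. So the axioms for the dual amount to the following identities on \<open>V\<close>.

  \<^item> Commutator axiom: \<open>S\<close> represents the commutator Lie algebra, i.e. \<open>S (a b - b a) = [S a, S b]\<close>;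
    the sign of the transposed left action makes up for the reversal of the products. Adding the
    compatibility axiom for \<open>(a, b)\<close> to the commutator axiom and subtracting it for \<open>(b, a)\<close> gives
    this, because the operators \<open>r a\<close> commute.
  \<^item> Compatibility axiom: \<open>[S a, r b] = [l a, r b]\<close>, because the operators \<open>r a\<close> commute, so
    compatibility for \<open>V\<close> applies.
  \<^item> Product axiom: \<open>S (a b) = S a (r b)\<close>. Here compatibility is used to commute \<open>l a\<close> past \<open>r b\<close>,
    after which \<open>l (a b) = r b (l a)\<close> applies.
  \<^item> Commutation of the right actions is unchanged by reversing products.
\<close>

lemma vector_space_scale_fun: "vector_space (scale_fun :: 'k::field \<Rightarrow> ('v \<Rightarrow> 'k) \<Rightarrow> 'v \<Rightarrow> 'k)"
  by standard (auto simp: scale_fun_def fun_eq_iff algebra_simps)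

lemma dual_space_iff:
  fixes scale :: "'k::field \<Rightarrow> 'v::ab_group_add \<Rightarrow> 'v"
  assumes "vector_space scale"
  shows "f \<in> dual_space scale \<longleftrightarrow>
    (\<forall>v w. f (v + w) = f v + f w) \<and> (\<forall>c v. f (scale c v) = c * f v)"
proof -
  have "vector_space ((*) :: 'k \<Rightarrow> 'k \<Rightarrow> 'k)"
    by standard (simp_all add: algebra_simps)
  with assms show ?thesis
    by (simp add: dual_space_def Vector_Spaces.linear_iff)
qed

lemma subspace_dual_space:
  assumes "vector_space scale"
  shows "module.subspace scale_fun (dual_space scale)"
proof -
  interpret F: vector_space scale_fun by (rule vector_space_scale_fun)
  show ?thesis
    unfolding F.subspace_def
    by (auto simp: dual_space_iff[OF assms] scale_fun_def algebra_simps)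
qed

context novikov_representation
begin

text \<open>
  Minus the transpose of this identity is the commutator axiom for the dual. Commutation of the
  right actions removes two terms \<open>[r a, r b]\<close>: one from the expansion of \<open>[l a + r a, l b + r b]\<close>,
  the other left over from the two uses of compatibility.
\<close>

lemma left_plus_right_commutator:
  assumes "v \<in> V"
  shows "l (a \<circ>\<^sub>A b - b \<circ>\<^sub>A a) v + r (a \<circ>\<^sub>A b - b \<circ>\<^sub>A a) v
    = (l a (l b v + r b v) + r a (l b v + r b v)) - (l b (l a v + r a v) + r b (l a v + r a v))"
proof -
  have mem: "l x v \<in> V" "r x v \<in> V" for x
    using assms l_End[of x] r_End[of x] by (auto simp: End_on_def)
  have add: "l x (l y v + r y v) = l x (l y v) + l x (r y v)"
    "r x (l y v + r y v) = r x (l y v) + r x (r y v)" for x y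
    using mem l_End[of x] r_End[of x] by (auto simp: End_on_def)
  have "r (a \<circ>\<^sub>A b - b \<circ>\<^sub>A a) v + r (b \<circ>\<^sub>A a) v = r (a \<circ>\<^sub>A b) v"
    using r_add[OF assms, of "a \<circ>\<^sub>A b - b \<circ>\<^sub>A a" "b \<circ>\<^sub>A a"] by simp
  then have "r (a \<circ>\<^sub>A b - b \<circ>\<^sub>A a) v = r (a \<circ>\<^sub>A b) v - r (b \<circ>\<^sub>A a) v"
    by (simp add: algebra_simps)
  also have "\<dots> = (l a (r b v) - r b (l a v) + r b (r a v))
      - (l b (r a v) - r a (l b v) + r a (r b v))"
    by (simp add: l_r[OF assms])
  finally show ?thesis
    by (simp add: add l_commutator[OF assms] r_commute[OF assms, of a b] algebra_simps)
qed

text \<open>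
  The transpose of this identity is the product axiom for the dual. It explains why \<open>r\<close> has to be
  added to \<open>l\<close> in the dual left action: \<open>l (a b) = r b (l a)\<close> has its factors in the wrong order,
  and compatibility shows that adding \<open>r\<close> corrects it.
\<close>

lemma left_plus_right_mult:
  assumes "v \<in> V"
  shows "l (a \<circ>\<^sub>A b) v + r (a \<circ>\<^sub>A b) v = l a (r b v) + r a (r b v)"
proof -
  have "r (a \<circ>\<^sub>A b) v = l a (r b v) - r b (l a v) + r b (r a v)"
    by (simp add: l_r[OF assms])
  then show ?thesis
    by (simp add: l_mult[OF assms] r_commute[OF assms, of a b])
qed

end

theorem proposition3p3:
  fixes scaleA :: "'k::field_char_0 \<Rightarrow> 'a::ab_group_add \<Rightarrow> 'a"
    and mult :: "'a \<Rightarrow> 'a \<Rightarrow> 'a"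
    and scaleV :: "'k \<Rightarrow> 'v::ab_group_add \<Rightarrow> 'v"
    and l r :: "'a \<Rightarrow> 'v \<Rightarrow> 'v"
  assumes "novikov_algebra scaleA mult" and "finite_dimensional scaleA"
    and "novikov_representation scaleA mult scaleV UNIV l r" and "finite_dimensional scaleV"
  shows "novikov_representation scaleA mult scale_fun (dual_space scaleV)
           (dual_map l + dual_map r) (- dual_map r)"
proof -
  interpret N: novikov_representation scaleA mult scaleV UNIV l r by (rule assms(3))
  interpret F: vector_space "scale_fun :: 'k \<Rightarrow> ('v \<Rightarrow> 'k) \<Rightarrow> 'v \<Rightarrow> 'k"
    by (rule vector_space_scale_fun)
  let ?D = "dual_space scaleV"
  let ?L = "dual_map l + dual_map r :: 'a \<Rightarrow> ('v \<Rightarrow> 'k) \<Rightarrow> 'v \<Rightarrow> 'k"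
  let ?R = "- dual_map r :: 'a \<Rightarrow> ('v \<Rightarrow> 'k) \<Rightarrow> 'v \<Rightarrow> 'k"
  note D = dual_space_iff[OF N.V.vector_space_axioms]
  have add: "f (v + w) = f v + f w" and scale: "f (scaleV c v) = c * f v" if "f \<in> ?D" for f v w c
    using that by (simp_all add: D)
  have diff: "f (v - w) = f v - f w" if "f \<in> ?D" for f v w
    using add[OF that, of "v - w" w] by (simp add: algebra_simps)
  have op: "l a (v + w) = l a v + l a w" "r a (v + w) = r a v + r a w"
    "l a (scaleV c v) = scaleV c (l a v)" "r a (scaleV c v) = scaleV c (r a v)" for a v w c
    using N.l_End[of a] N.r_End[of a] by (auto simp: End_on_def)
  have L: "?L a f v = - f (l a v) - f (r a v)" for a f v
    by (simp add: dual_map_def)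
  have LD: "?L a f v = - f (l a v + r a v)" if "f \<in> ?D" for a f v
    using add[OF that] by (simp add: dual_map_def)
  have R: "?R a f v = f (r a v)" for a f v
    by (simp add: dual_map_def)
  have L_mem: "?L a f \<in> ?D" if "f \<in> ?D" for a f
    unfolding D L using that by (simp add: op add scale algebra_simps)
  have R_mem: "?R a f \<in> ?D" if "f \<in> ?D" for a f
    unfolding D R using that by (simp add: op add scale)
  show ?thesis
  proof
    show "F.subspace ?D"
      by (rule subspace_dual_space[OF N.V.vector_space_axioms])
    show "?L a \<in> End_on scale_fun ?D" for a
      unfolding End_on_def mem_Collect_eq
      by (intro conjI ballI allI L_mem)
        (simp_all add: fun_eq_iff dual_map_def scale_fun_def algebra_simps)
    show "?R a \<in> End_on scale_fun ?D" for a
      unfolding End_on_def mem_Collect_eq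
      by (intro conjI ballI allI R_mem) (simp_all add: fun_eq_iff dual_map_def scale_fun_def)
    fix f assume f: "f \<in> ?D"
    fix a b
    show "?L (a + b) f = ?L a f + ?L b f"
      by (simp add: fun_eq_iff dual_map_def N.l_add N.r_add add[OF f] algebra_simps)
    show "?R (a + b) f = ?R a f + ?R b f"
      by (simp add: fun_eq_iff dual_map_def N.r_add add[OF f])
    show "?L (scaleA c a) f = scale_fun c (?L a f)" for c
      by (simp add: fun_eq_iff dual_map_def N.l_scale N.r_scale scale[OF f] scale_fun_def
          algebra_simps)
    show "?R (scaleA c a) f = scale_fun c (?R a f)" for c
      by (simp add: fun_eq_iff dual_map_def N.r_scale scale[OF f] scale_fun_def)
    show "?L (mult a b - mult b a) f = ?L a (?L b f) - ?L b (?L a f)"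
    proof
      fix v
      have "?L (mult a b - mult b a) f v
          = f (l b (l a v + r a v) + r b (l a v + r a v))
          - f (l a (l b v + r b v) + r a (l b v + r b v))"
        unfolding LD[OF f] N.left_plus_right_commutator[OF UNIV_I] diff[OF f] by simp
      also have "\<dots> = (?L a (?L b f) - ?L b (?L a f)) v"
        unfolding minus_apply LD[OF L_mem[OF f]] LD[OF f] by simp
      finally show "?L (mult a b - mult b a) f v = (?L a (?L b f) - ?L b (?L a f)) v" .
    qed
    show "?L a (?R b f) - ?R b (?L a f) = ?R (mult a b) f - ?R b (?R a f)"
    proof
      fix v
      have "f (l a (r b v)) - f (r b (l a v)) = f (r (mult a b) v) - f (r b (r a v))"
        using arg_cong[OF N.l_r[OF UNIV_I, of a b v], of f] by (simp add: diff[OF f])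
      then show "(?L a (?R b f) - ?R b (?L a f)) v = (?R (mult a b) f - ?R b (?R a f)) v"
        unfolding minus_apply L R N.r_commute[OF UNIV_I, of a b] by (simp add: algebra_simps)
    qed
    show "?L (mult a b) f = ?R b (?L a f)"
    proof
      fix v
      show "?L (mult a b) f v = ?R b (?L a f) v"
        unfolding R LD[OF f] N.left_plus_right_mult[OF UNIV_I] ..
    qed
    show "?R a (?R b f) = ?R b (?R a f)"
      by (simp add: fun_eq_iff dual_map_def N.r_commute[of _ a b])
  qed
qed

end
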